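(* Let $f(x)=\sum_{n\geq 0}c_n x^n$, where $\mathbf{c}=(c_n)_{n\geq 0}$ is the Cantor sequence. Then for any $n\geq 1$, the $(n-1,n)$-order Padé approximant of $f$ exists.
   Context: The Cantor sequence $\mathbf{c}=c_0c_1c_2\cdots\in\{0,1\}^{\mathbb{N}}$ is defined by $c_0=1$, $c_{3n}=c_n$, $c_{3n+1}=0$, $c_{3n+2}=c_n$ for $n\ge 0$. A $(p,q)$-order Padé approximant of $f$ is a rational function $P(x)/Q(x)$ whose denominator has degree $q$ and whose numerator has degree $p$ such that $f(x)-\frac{P(x)}{Q(x)}=O(x^{p+q+1})$ as $x\to 0$.
   Formalization: The orders p and q are taken as upper bounds for the degrees of numerator and denominator, not exact degrees; with exact degrees the claim is false (for n=1, a/(b+cx)=1+O(x^2) forces c=0; since f is even, exact degrees n-1 and n never occur). *)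

theory Defs
  imports
    Complex_Main
    "HOL-Computational_Algebra.Polynomial"
    "HOL-Library.Landau_Symbols"
begin

fun cantor :: "nat \<Rightarrow> nat" where
  "cantor n =
     (if n = 0 then 1
      else if n mod 3 = 1 then 0
      else cantor (n div 3))"

declare cantor.simps [simp del]

lemma cantor_0: "cantor 0 = 1"
  by (simp add: cantor.simps)

lemma cantor_mult_3: "cantor (3 * n) = cantor n"
  by (cases "n = 0") (simp_all add: cantor.simps [of "3 * n"])

lemma cantor_mult_3_plus_1: "cantor (3 * n + 1) = 0"
proof -
  have "(3 * n + 1) mod 3 = 1" by presburger
  then show ?thesis by (subst cantor.simps) simp
qed

lemma cantor_mult_3_plus_2: "cantor (3 * n + 2) = cantor n"
proof -
  have "(3 * n + 2) mod 3 = 2" "(3 * n + 2) div 3 = n" by presburger+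
  then show ?thesis by (subst cantor.simps) simp
qed

text \<open>The series converges for \<open>\<bar>x\<bar> < 1\<close>; only its germ at 0 is used.\<close>

definition cantor_series :: "real \<Rightarrow> real" where
  "cantor_series x = (\<Sum>n. real (cantor n) * x ^ n)"

text \<open>
  As usual for Pade approximants, the orders are upper bounds for the degrees. With equality
  the approximant of order (0, 1) of the Cantor series \<open>1 + x^2 + x^6 + \<dots>\<close> would not exist:
  \<open>a / (b + c * x) = 1 + O(x^2)\<close> forces \<open>c = 0\<close>.

  The filter \<open>at 0\<close> excludes the point 0, and a nonzero \<open>Q\<close> has no other zeros near 0, so the
  totalised division plays no role. If \<open>f\<close> is bounded near 0, the condition forces any zero of
  \<open>Q\<close> at 0 to be cancelled by \<open>P\<close>.
\<close>

definition is_pade_approximant ::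
    "nat \<Rightarrow> nat \<Rightarrow> (real \<Rightarrow> real) \<Rightarrow> real poly \<Rightarrow> real poly \<Rightarrow> bool" where
  "is_pade_approximant p q f P Q \<longleftrightarrow>
     Q \<noteq> 0 \<and> degree P \<le> p \<and> degree Q \<le> q \<and>
     (\<lambda>x. f x - poly P x / poly Q x) \<in> O[at 0](\<lambda>x. x ^ (p + q + 1))"

end

theory Submission
  imports
    Defs
    "HOL-Computational_Algebra.Formal_Power_Series"
    "HOL-Number_Theory.Cong"
    "Jordan_Normal_Form.Determinant"
begin

text \<open>
  Modulo 3, the generating function \<open>F\<close> of the Cantor sequence is an inverse square root of
  \<open>1 + x\<^sup>2\<close>. Denominators of its approximants are read off from the powers of
  \<open>1 - sqrt (1 + x\<^sup>2)\<close>; they show that no Hankel determinant of the Cantor sequence is divisible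
  by 3. So the linear system for an integral denominator with nonzero constant term is solvable.
\<close>

section \<open>Coefficients of formal power series\<close>

lemma fps_nth_compose_X_power:
  fixes f :: "'a::comm_ring_1 fps"
  assumes "m > 0"
  shows "fps_nth (fps_compose f (fps_X ^ m)) n = (if m dvd n then fps_nth f (n div m) else 0)"
proof -
  have "fps_nth (fps_compose f (fps_X ^ m)) n
      = (\<Sum>i = 0..n. if n = m * i then fps_nth f i else 0)"
    unfolding fps_compose_nth
    by (intro sum.cong refl) (simp flip: power_mult add: fps_X_power_nth)
  also have "\<dots> = (\<Sum>i = 0..n. if m dvd n \<and> i = n div m then fps_nth f i else 0)"
    using assms by (intro sum.cong refl if_cong) auto
  also have "\<dots> = (if m dvd n then fps_nth f (n div m) else 0)"
    by (cases "m dvd n") (simp_all add: sum.delta)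
  finally show ?thesis .
qed

lemma fps_numeral_mult_nth:
  fixes f :: "'a::comm_ring_1 fps"
  shows "fps_nth (numeral k * f) n = numeral k * fps_nth f n"
  by (simp add: numeral_fps_const)

section \<open>The Cantor generating function and its approximants modulo 3\<close>

lemma cantor_le_1: "cantor n \<le> 1"
proof (induction n rule: less_induct)
  case (less n)
  then show ?case by (subst cantor.simps) auto
qed

definition cantor_fps :: "int fps" where
  "cantor_fps = Abs_fps (\<lambda>n. int (cantor n))"

lemma fps_nth_cantor_fps: "fps_nth cantor_fps n = int (cantor n)"
  by (simp add: cantor_fps_def)

lemma cantor_1: "cantor 1 = 0" and cantor_2: "cantor 2 = 1"
  by (simp_all add: cantor.simps)

text \<open>The indices \<open>3 * m\<close> and \<open>3 * m + 2\<close> both carry the coefficient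
  \<open>cantor m\<close>, and the index \<open>3 * m + 1\<close> carries 0; so each
  \<open>x^m\<close> is replaced by \<open>x^(3 m) + x^(3 m + 2)\<close>.\<close>

lemma cantor_fps_functional_equation:
  "cantor_fps = (1 + fps_X ^ 2) * fps_compose cantor_fps (fps_X ^ 3)"
proof (rule fps_ext)
  fix n :: nat
  have eq: "fps_nth ((1 + fps_X ^ 2) * fps_compose cantor_fps (fps_X ^ 3)) n =
     (if 3 dvd n then int (cantor (n div 3)) else 0)
     + (if n < 2 then 0 else if 3 dvd n - 2 then int (cantor ((n - 2) div 3)) else 0)"
    by (simp add: distrib_right fps_X_power_mult_nth fps_nth_compose_X_power fps_nth_cantor_fps)
  consider m where "n = 3 * m" | m where "n = 3 * m + 1" | m where "n = 3 * m + 2"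
  proof -
    have "n = 3 * (n div 3) \<or> n = 3 * (n div 3) + 1 \<or> n = 3 * (n div 3) + 2" by presburger
    then show thesis using that by metis
  qed
  then show "fps_nth cantor_fps n
      = fps_nth ((1 + fps_X ^ 2) * fps_compose cantor_fps (fps_X ^ 3)) n"
  proof cases
    case 1
    have "\<not> 3 dvd n - 2" if "n \<ge> 2" using 1 that by presburger
    then show ?thesis unfolding eq by (auto simp: 1 fps_nth_cantor_fps cantor_mult_3)
  next
    case 2
    have "\<not> 3 dvd n - 2" if "n \<ge> 2" using 2 that by presburger
    moreover have "\<not> 3 dvd n" using 2 by presburger
    moreover have "cantor n = 0" unfolding 2 by (rule cantor_mult_3_plus_1)
    ultimately show ?thesis unfolding eq by (simp add: fps_nth_cantor_fps)
  next
    case 3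
    have "\<not> 3 dvd n" using 3 by presburger
    moreover have "cantor n = cantor m" unfolding 3 by (rule cantor_mult_3_plus_2)
    ultimately show ?thesis unfolding eq using 3 by (simp add: fps_nth_cantor_fps)
  qed
qed

text \<open>
  The difference \<open>D = (1 + x\<^sup>2) F\<^sup>2 - 1\<close> satisfies \<open>D(x) = D(x\<^sup>3)\<close> modulo 3, because
  \<open>(1 + x\<^sup>2)\<^sup>3 = 1 + x\<^sup>6\<close> modulo 3; hence it is constant modulo 3.
\<close>

lemma cantor_fps_square_mod_3:
  obtains K where "(1 + fps_X ^ 2) * cantor_fps ^ 2 = 1 + 3 * K"
proof -
  define D where "D = (1 + fps_X ^ 2) * cantor_fps ^ 2 - 1"
  define C where "C = fps_compose cantor_fps (fps_X ^ 3)"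
  have F: "cantor_fps = (1 + fps_X ^ 2) * C"
    unfolding C_def by (rule cantor_fps_functional_equation)
  have X0: "fps_nth (fps_X ^ 3 :: int fps) 0 = 0"
    by (simp add: fps_X_power_nth)
  have "fps_compose D (fps_X ^ 3) = (1 + (fps_X ^ 3) ^ 2) * C ^ 2 - 1"
    unfolding D_def C_def
    by (simp add: fps_compose_sub_distrib fps_compose_add_distrib X0
          fps_compose_mult_distrib fps_compose_power[symmetric])
  \<comment> \<open>Inserting \<open>F\<close> turns \<open>D\<close> into
    \<open>(1 + X^2)^3 C^2 - 1\<close>; the two middle binomial terms of the cube make up the
    multiple of 3.\<close>
  then have D: "D = fps_compose D (fps_X ^ 3) + 3 * ((fps_X ^ 2 + fps_X ^ 4) * C ^ 2)"
    unfolding D_def F by (simp add: algebra_simps power2_eq_square power3_eq_cube power4_eq_xxxx)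
  have step: "fps_nth D n = (if 3 dvd n then fps_nth D (n div 3) else 0)
      + 3 * fps_nth ((fps_X ^ 2 + fps_X ^ 4) * C ^ 2) n" for n
    by (subst D) (simp add: fps_nth_compose_X_power fps_numeral_mult_nth)
  have D0: "fps_nth D 0 = 0"
    by (simp add: D_def fps_nth_cantor_fps cantor_0 power2_eq_square)
  \<comment> \<open>For positive \<open>n\<close>, \<open>step\<close> leads to the smaller index
    \<open>n div 3\<close> or directly to a multiple of 3; the descent ends at
    \<open>D0\<close>.\<close>
  have "3 dvd fps_nth D n" for n
  proof (induction n rule: less_induct)
    case (less n)
    show ?case
    proof (cases "n = 0")
      case False
      then have "3 dvd fps_nth D (n div 3)" by (intro less) auto
      then show ?thesis by (subst step) auto
    qed (simp add: D0)
  qed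
  then have "D = 3 * Abs_fps (\<lambda>n. fps_nth D n div 3)"
    by (intro fps_ext) (simp add: fps_numeral_mult_nth)
  then obtain K where "D = 3 * K" ..
  then have "(1 + fps_X ^ 2) * cantor_fps ^ 2 = 1 + 3 * K"
    by (simp add: D_def diff_eq_eq add.commute)
  then show thesis by (rule that)
qed

text \<open>
  With \<open>G = (1 + x\<^sup>2) F\<close>, a square root of \<open>1 + x\<^sup>2\<close> modulo 3, expand \<open>(1 - G)\<^sup>n = t - u G\<close>.
  Since \<open>G F = 1\<close> modulo 3, this gives \<open>t F - u = (1 - G)\<^sup>n F\<close>, whose leading term modulo 3 is
  \<open>x^(2 n)\<close> because \<open>1 - G = -2 x\<^sup>2 + \<dots>\<close>.
\<close>

lemma cantor_pade_denominator_mod_3: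
  obtains t :: "int fps" where
    "\<And>k. k > n \<Longrightarrow> fps_nth t k = 0"
    "\<And>k. n \<le> k \<Longrightarrow> k < 2 * n \<Longrightarrow> [fps_nth (t * cantor_fps) k = 0] (mod 3)"
    "[fps_nth (t * cantor_fps) (2 * n) = 1] (mod 3)"
proof -
  obtain K where K: "(1 + fps_X ^ 2) * cantor_fps ^ 2 = 1 + 3 * K"
    using cantor_fps_square_mod_3 .
  define G where "G = (1 + fps_X ^ 2) * cantor_fps"
  define E where "E = fps_shift 2 (1 - G)"
  have GF: "G * cantor_fps = 1 + 3 * K"
    using K by (simp add: G_def power2_eq_square mult.assoc)
  have GG: "G * G = 1 + fps_X ^ 2 + 3 * ((1 + fps_X ^ 2) * K)"
  proof -
    have "G * G = (1 + fps_X ^ 2) * (G * cantor_fps)" by (simp add: G_def mult_ac)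
    then show ?thesis unfolding GF by (simp add: algebra_simps)
  qed
  have G_nth: "fps_nth G k = int (cantor k) + (if k < 2 then 0 else int (cantor (k - 2)))" for k
    by (simp add: G_def distrib_right fps_X_power_mult_nth fps_nth_cantor_fps)
  \<comment> \<open>\<open>G\<close> begins with \<open>1 + 0 x + 2 x^2\<close>, so the shift that
    defines \<open>E\<close> drops only zeros.\<close>
  have E: "1 - G = fps_X ^ 2 * E"
  proof (rule fps_ext)
    fix k :: nat
    consider "k = 0" | "k = 1" | "k \<ge> 2" by linarith
    then show "fps_nth (1 - G) k = fps_nth (fps_X ^ 2 * E) k"
    proof cases
      case 3
      then obtain m where "k = m + 2" by (metis add.commute le_Suc_ex)
      then show ?thesis by (simp add: E_def fps_X_power_mult_nth)
    qed (simp_all add: G_nth fps_X_power_mult_nth cantor_0 cantor_1 del: One_nat_def)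
  qed
  have E0: "fps_nth E 0 = -2"
    by (simp add: E_def G_nth cantor_0 cantor_2[unfolded numeral_2_eq_2] numeral_2_eq_2)
  \<comment> \<open>The vanishing conditions bound the degree of \<open>t\<close> by
    \<open>n\<close> and that of \<open>u\<close> strictly by \<open>n\<close>. Multiplying
    \<open>t - u G\<close> by \<open>1 - G\<close> and replacing \<open>G^2\<close> by
    \<open>1 + X^2\<close> modulo 3 gives the new pair \<open>t + (1 + X^2) u\<close> and
    \<open>t + u\<close>, with both bounds raised by one.\<close>
  have "\<exists>t u k. (1 - G) ^ n = t - u * G + 3 * k
     \<and> (\<forall>i>n. fps_nth t i = 0) \<and> (\<forall>i\<ge>n. fps_nth u i = 0)"
  proof (induction n)
    case 0
    show ?case by (rule exI[of _ 1], rule exI[of _ 0], rule exI[of _ 0]) simp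
  next
    case (Suc n)
    then obtain t u k where IH: "(1 - G) ^ n = t - u * G + 3 * k"
      and t: "\<forall>i>n. fps_nth t i = 0" and u: "\<forall>i\<ge>n. fps_nth u i = 0" by blast
    have "(1 - G) ^ Suc n = t - u * G + 3 * k - t * G - 3 * k * G + u * (G * G)"
      unfolding power_Suc IH by (simp add: algebra_simps)
    also have "\<dots> = (t + (1 + fps_X ^ 2) * u) - (t + u) * G
        + 3 * (k - k * G + u * ((1 + fps_X ^ 2) * K))"
      unfolding GG by (simp add: algebra_simps)
    finally have "(1 - G) ^ Suc n = (t + (1 + fps_X ^ 2) * u) - (t + u) * G
        + 3 * (k - k * G + u * ((1 + fps_X ^ 2) * K))" .
    moreover have "\<forall>i>Suc n. fps_nth (t + (1 + fps_X ^ 2) * u) i = 0"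
      using t u by (simp add: distrib_right fps_X_power_mult_nth)
    moreover have "\<forall>i\<ge>Suc n. fps_nth (t + u) i = 0"
      using t u by simp
    ultimately show ?case by blast
  qed
  then obtain t u k where tuk: "(1 - G) ^ n = t - u * G + 3 * k"
     and t: "\<And>i. i > n \<Longrightarrow> fps_nth t i = 0" and u: "\<And>i. i \<ge> n \<Longrightarrow> fps_nth u i = 0" by blast
  have "t * cantor_fps = (1 - G) ^ n * cantor_fps + u * (G * cantor_fps) - 3 * k * cantor_fps"
    unfolding tuk by (simp add: algebra_simps)
  also have "\<dots> = fps_X ^ (2 * n) * (E ^ n * cantor_fps) + u + 3 * (u * K - k * cantor_fps)"
    unfolding GF E power_mult_distrib power_mult by (simp add: algebra_simps)
  finally have tF: "fps_nth (t * cantor_fps) i =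
      (if i < 2 * n then 0 else fps_nth (E ^ n * cantor_fps) (i - 2 * n))
      + fps_nth u i + 3 * fps_nth (u * K - k * cantor_fps) i" for i
    by (simp only: fps_add_nth fps_X_power_mult_nth fps_numeral_mult_nth)
  show thesis
  proof (rule that)
    show "fps_nth t i = 0" if "i > n" for i using t that .
    \<comment> \<open>From index \<open>n\<close> on \<open>u\<close> contributes nothing, and the
      power of \<open>1 - G\<close> starts only at index \<open>2 * n\<close>; a multiple of 3
      remains.\<close>
    show "[fps_nth (t * cantor_fps) i = 0] (mod 3)" if "n \<le> i" "i < 2 * n" for i
      unfolding tF using that u by (simp add: cong_0_iff)
    \<comment> \<open>At index \<open>2 * n\<close> the constant term \<open>(-2)^n\<close> of
      \<open>E^n F\<close> appears, and -2 is 1 modulo 3.\<close>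
    have "[(-2) ^ n = 1 ^ n] (mod 3 :: int)" by (intro cong_pow) (simp add: cong_def)
    moreover have "[fps_nth (t * cantor_fps) (2 * n) = (-2) ^ n] (mod 3)"
      unfolding tF using u
      by (simp add: fps_power_zeroth E0 fps_nth_cantor_fps cantor_0 cong_iff_dvd_diff)
    ultimately show "[fps_nth (t * cantor_fps) (2 * n) = 1] (mod 3)"
      by (metis cong_trans power_one)
  qed
qed

section \<open>Hankel determinants and the linear system for the denominator\<close>

text \<open>The Leibniz formula is a polynomial in the entries with integer coefficients.\<close>

lemma cong_det:
  fixes A B :: "int mat"
  assumes "A \<in> carrier_mat n n" "B \<in> carrier_mat n n"
    and "\<And>i j. i < n \<Longrightarrow> j < n \<Longrightarrow> [A $$ (i, j) = B $$ (i, j)] (mod m)"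
  shows "[det A = det B] (mod m)"
  unfolding det_def'[OF assms(1)] det_def'[OF assms(2)]
proof (intro cong_sum cong_mult cong_refl cong_prod)
  fix p i assume "p \<in> {p. p permutes {0..<n}}" "i \<in> {0..<n}"
  then show "[A $$ (i, p i) = B $$ (i, p i)] (mod m)"
    by (intro assms(3)) (auto simp: permutes_in_image)
qed

definition cantor_hankel :: "nat \<Rightarrow> int mat" where
  "cantor_hankel n = mat n n (\<lambda>(i, j). int (cantor (i + j)))"

lemma cantor_hankel_carrier [simp]: "cantor_hankel n \<in> carrier_mat n n"
  by (simp add: cantor_hankel_def)

text \<open>Multiplied by a matrix built from the denominators \<open>t j\<close>, the Hankel matrix
  becomes modulo 3 lower triangular with ones on the diagonal. Its determinant thus divides an
  integer congruent to 1 modulo 3.\<close>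

lemma det_cantor_hankel_nonzero: "det (cantor_hankel n) \<noteq> 0"
proof -
  obtain t :: "nat \<Rightarrow> int fps" where
    t: "\<And>j k. k > j \<Longrightarrow> fps_nth (t j) k = 0"
       "\<And>j k. j \<le> k \<Longrightarrow> k < 2 * j \<Longrightarrow> [fps_nth (t j * cantor_fps) k = 0] (mod 3)"
       "\<And>j. [fps_nth (t j * cantor_fps) (2 * j) = 1] (mod 3)"
  proof -
    have "\<forall>j. \<exists>t. (\<forall>k>j. fps_nth t k = 0)
        \<and> (\<forall>k. j \<le> k \<longrightarrow> k < 2 * j \<longrightarrow> [fps_nth (t * cantor_fps) k = 0] (mod 3))
        \<and> [fps_nth (t * cantor_fps) (2 * j) = 1] (mod 3)"
      by (metis cantor_pade_denominator_mod_3)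
    then show thesis using that by metis
  qed
  \<comment> \<open>Column \<open>j\<close> holds the coefficients of \<open>t j\<close> in reverse
    order, which turns the Hankel product into a Cauchy product.\<close>
  define B where "B = mat n n (\<lambda>(k, j). if k \<le> j then fps_nth (t j) (j - k) else 0)"
  \<comment> \<open>For \<open>i < j\<close> the index \<open>i + j\<close> lies in the gap from
    \<open>j\<close> to \<open>2 j - 1\<close>, and \<open>i = j\<close> gives \<open>2 j\<close>.
    The entries below the diagonal are just copied, since they do not affect the
    determinant.\<close>
  define L where "L = mat n n (\<lambda>(i, j). if i < j then 0 else if i = j then 1
                         else fps_nth (t j * cantor_fps) (i + j))"
  have B: "B \<in> carrier_mat n n" and L: "L \<in> carrier_mat n n" by (simp_all add: B_def L_def)
  have prod: "(cantor_hankel n * B) $$ (i, j) = fps_nth (t j * cantor_fps) (i + j)"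
    if "i < n" "j < n" for i j
  proof -
    have "(cantor_hankel n * B) $$ (i, j)
        = (\<Sum>k\<in>{0..<n}. int (cantor (i + k)) * (if k \<le> j then fps_nth (t j) (j - k) else 0))"
      using that by (simp add: cantor_hankel_def B_def scalar_prod_def)
    also have "\<dots> = (\<Sum>k\<in>{0..j}. int (cantor (i + k)) * fps_nth (t j) (j - k))"
      using that by (intro sum.mono_neutral_cong_right) auto
    also have "\<dots> = (\<Sum>m\<in>{0..j}. fps_nth (t j) m * int (cantor (i + j - m)))"
      by (rule sum.reindex_bij_witness[of _ "\<lambda>m. j - m" "\<lambda>m. j - m"]) auto
    also have "\<dots> = (\<Sum>m\<in>{0..i + j}. fps_nth (t j) m * int (cantor (i + j - m)))"
      using t(1) by (intro sum.mono_neutral_left) auto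
    also have "\<dots> = fps_nth (t j * cantor_fps) (i + j)"
      by (simp add: fps_mult_nth fps_nth_cantor_fps)
    finally show ?thesis .
  qed
  have "[det (cantor_hankel n * B) = det L] (mod 3)"
  proof (rule cong_det)
    fix i j assume ij: "i < n" "j < n"
    have "[fps_nth (t j * cantor_fps) (i + j) = L $$ (i, j)] (mod 3)"
      using ij t(2)[of j "i + j"] t(3)[of j] by (auto simp: L_def mult_2)
    then show "[(cantor_hankel n * B) $$ (i, j) = L $$ (i, j)] (mod 3)"
      by (simp add: prod ij)
  qed (use B L in \<open>auto intro: mult_carrier_mat[OF cantor_hankel_carrier]\<close>)
  moreover have "det L = 1"
  proof -
    have "det L = prod_list (diag_mat L)"
      by (rule det_lower_triangular[OF _ L]) (simp add: L_def)
    also have "\<dots> = 1"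
      using L by (simp add: prod_list_diag_prod) (simp add: L_def)
    finally show ?thesis .
  qed
  ultimately have "[det (cantor_hankel n) * det B = 1] (mod 3)"
    using det_mult[OF cantor_hankel_carrier B] by simp
  then show ?thesis by (auto simp: cong_def)
qed

text \<open>Cramer's rule over the integers: the adjugate applied to \<open>b\<close> solves the
  Hankel system with right-hand side \<open>b\<close> scaled by the determinant. Appending minus the
  determinant gives the solution \<open>w\<close>; read backwards, it lists the coefficients of a
  denominator with constant term \<open>w n\<close>.\<close>

lemma cantor_denominator_coeffs:
  obtains w :: "nat \<Rightarrow> int" where "w n \<noteq> 0"
    "\<And>i. i < n \<Longrightarrow> (\<Sum>l\<le>n. w l * int (cantor (i + l))) = 0"
proof -
  define b where "b = vec n (\<lambda>i. int (cantor (i + n)))"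
  define v where "v = adj_mat (cantor_hankel n) *\<^sub>v b"
  note adj = adj_mat[OF cantor_hankel_carrier[of n]]
  have b: "b \<in> carrier_vec n" by (simp add: b_def)
  then have v: "v \<in> carrier_vec n" using adj(1) by (simp add: v_def)
  have "cantor_hankel n *\<^sub>v v = (cantor_hankel n * adj_mat (cantor_hankel n)) *\<^sub>v b"
    unfolding v_def using assoc_mult_mat_vec[OF cantor_hankel_carrier adj(1) b] by simp
  also have "\<dots> = det (cantor_hankel n) \<cdot>\<^sub>v b"
    unfolding adj(2) using b
    by (intro eq_vecI)
       (auto simp: scalar_prod_def b_def mult_delta_left mult_delta_right)
  finally have eq: "cantor_hankel n *\<^sub>v v = det (cantor_hankel n) \<cdot>\<^sub>v b" .
  define w where "w l = (if l < n then vec_index v l else - det (cantor_hankel n))" for l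
  show thesis
  proof (rule that[of w])
    show "w n \<noteq> 0" by (simp add: w_def det_cantor_hankel_nonzero)
    fix i assume i: "i < n"
    have "vec_index (cantor_hankel n *\<^sub>v v) i = (\<Sum>l<n. w l * int (cantor (i + l)))"
      using i v by (auto simp: scalar_prod_def cantor_hankel_def w_def atLeast0LessThan
          intro!: sum.cong)
    then have "(\<Sum>l<n. w l * int (cantor (i + l))) = det (cantor_hankel n) * int (cantor (i + n))"
      unfolding eq using i by (simp add: b_def)
    then show "(\<Sum>l\<le>n. w l * int (cantor (i + l))) = 0"
      by (simp flip: lessThan_Suc_atMost add: w_def)
  qed
qed

section \<open>The analytic remainder and the approximant\<close>

text \<open>The coefficients are 0 or 1, so every tail, divided by its leading power of
  \<open>x\<close>, is dominated by a geometric series.\<close>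

lemma cantor_series_remainder:
  obtains g where "g \<in> O[at 0](\<lambda>_. 1)"
    "\<And>x. \<bar>x\<bar> < 1 \<Longrightarrow>
       cantor_series x = poly (\<Sum>k<N. monom (real (cantor k)) k) x + x ^ N * g x"
proof -
  have summable: "summable (\<lambda>k. real (cantor (k + N)) * x ^ k)" if "\<bar>x\<bar> < 1" for x N
  proof (rule summable_comparison_test')
    show "summable (\<lambda>k. \<bar>x\<bar> ^ k)" using that by (simp add: summable_geometric)
    show "norm (real (cantor (k + N)) * x ^ k) \<le> \<bar>x\<bar> ^ k" for k
      using cantor_le_1[of "k + N"] by (simp add: abs_mult power_abs mult_left_le_one_le)
  qed
  define g where "g x = (\<Sum>k. real (cantor (k + N)) * x ^ k)" for x :: real
  show thesis
  proof (rule that)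
    have "\<bar>g x\<bar> \<le> 2" if "\<bar>x\<bar> < 1 / 2" for x
    proof -
      have "\<bar>g x\<bar> \<le> (\<Sum>k. (1 / 2) ^ k)"
        unfolding g_def real_norm_def[symmetric]
      proof (rule norm_suminf_le)
        fix k
        have "\<bar>x\<bar> ^ k \<le> (1 / 2) ^ k" using that by (intro power_mono) auto
        then show "norm (real (cantor (k + N)) * x ^ k) \<le> (1 / 2) ^ k"
          using cantor_le_1[of "k + N"] 
            mult_left_le_one_le[of "\<bar>x\<bar> ^ k" "real (cantor (k + N))"]
          by (simp add: abs_mult power_abs)
      qed (simp add: summable_geometric)
      also have "\<dots> = 2" by (subst suminf_geometric) auto
      finally show ?thesis .
    qed
    moreover have "\<forall>\<^sub>F x in at (0::real). \<bar>x\<bar> < 1 / 2"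
      unfolding eventually_at by (intro exI[of _ "1/2"]) (simp add: dist_real_def)
    ultimately show "g \<in> O[at 0](\<lambda>_. 1)"
      by (intro bigoI[of _ 2]) (auto elim!: eventually_mono)
    fix x :: real assume x: "\<bar>x\<bar> < 1"
    have "cantor_series x = (\<Sum>k. real (cantor (k + N)) * x ^ (k + N))
        + (\<Sum>k<N. real (cantor k) * x ^ k)"
      unfolding cantor_series_def using summable[OF x, of 0]
      by (intro suminf_split_initial_segment) simp
    also have "(\<Sum>k. real (cantor (k + N)) * x ^ (k + N)) = x ^ N * g x"
      unfolding g_def using suminf_mult[OF summable[OF x, of N], of "x ^ N"]
      by (simp add: power_add mult_ac)
    finally show "cantor_series x = poly (\<Sum>k<N. monom (real (cantor k)) k) x + x ^ N * g x"
      by (simp add: poly_sum poly_monom)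
  qed
qed

theorem theorem4:
  fixes n :: nat
  assumes "n \<ge> 1"
  shows "\<exists>P Q. is_pade_approximant (n - 1) n cantor_series P Q"
proof -
  obtain w where w0: "w n \<noteq> 0"
    and w: "\<And>i. i < n \<Longrightarrow> (\<Sum>l\<le>n. w l * int (cantor (i + l))) = 0"
    using cantor_denominator_coeffs[of n] by blast
  obtain g where g: "g \<in> O[at 0](\<lambda>_. 1)"
    and series: "\<And>x. \<bar>x\<bar> < 1 \<Longrightarrow>
       cantor_series x = poly (\<Sum>k<2 * n. monom (real (cantor k)) k) x + x ^ (2 * n) * g x"
    using cantor_series_remainder[of "2 * n"] by blast
  define T where "T = (\<Sum>k<2 * n. monom (real (cantor k)) k)"
  \<comment> \<open>The order of \<open>w\<close> is reversed so that the constant term is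
    \<open>w n\<close>, which is nonzero.\<close>
  define Q where "Q = (\<Sum>j\<le>n. monom (real_of_int (w (n - j))) j)"
  \<comment> \<open>The coefficients of \<open>Q * T\<close> at the indices from \<open>n\<close> to
    \<open>2 * n - 1\<close> vanish, so cutting off at \<open>n\<close> changes it only by a
    multiple of \<open>x^(2 n)\<close>.\<close>
  define P where "P = poly_cutoff n (Q * T)"
  have T_coeff: "coeff T k = (if k < 2 * n then real (cantor k) else 0)" for k
    by (simp add: T_def coeff_sum)
  have Q_coeff: "coeff Q j = (if j \<le> n then real_of_int (w (n - j)) else 0)" for j
    by (simp add: Q_def coeff_sum)
  have Q0: "poly Q 0 \<noteq> 0" using w0 by (simp add: poly_0_coeff_0 Q_coeff)
  have "coeff (Q * T) k = 0" if "n \<le> k" "k < 2 * n" for k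
  proof -
    have "coeff (Q * T) k = (\<Sum>j\<le>k. coeff Q j * coeff T (k - j))" by (rule coeff_mult)
    also have "\<dots> = (\<Sum>j\<le>n. real_of_int (w (n - j)) * real (cantor (k - j)))"
      using that by (intro sum.mono_neutral_cong_right) (auto simp: Q_coeff T_coeff)
    \<comment> \<open>With \<open>l = n - j\<close> this is equation \<open>k - n\<close> of the
      system for \<open>w\<close>.\<close>
    also have "\<dots> = (\<Sum>l\<le>n. real_of_int (w l) * real (cantor ((k - n) + l)))"
      using that
      by (intro sum.reindex_bij_witness[of _ "\<lambda>l. n - l" "\<lambda>l. n - l"]) auto
    also have "\<dots> = real_of_int (\<Sum>l\<le>n. w l * int (cantor ((k - n) + l)))" by simp
    also have "\<dots> = 0" using w[of "k - n"] that by simp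
    finally show ?thesis .
  qed
  then have "monom 1 (2 * n) dvd Q * T - P"
    by (auto simp: monom_1_dvd_iff' P_def coeff_poly_cutoff)
  then obtain R where R: "Q * T - P = monom 1 (2 * n) * R" by (rule dvdE)
  \<comment> \<open>Since \<open>Q\<close> does not vanish at 0, division by it is harmless near 0
    and keeps the remainder \<open>R / Q\<close> bounded.\<close>
  have evQ: "\<forall>\<^sub>F x in at 0. poly Q x \<noteq> 0"
    using Q0 by (intro tendsto_imp_eventually_ne[of _ "poly Q 0"] tendsto_intros)
  have "(\<lambda>x. poly R x / poly Q x) \<midarrow>0\<rightarrow> poly R 0 / poly Q 0"
    using Q0 by (intro tendsto_intros)
  then have "(\<lambda>x. poly R x / poly Q x / 1) \<midarrow>0\<rightarrow> poly R 0 / poly Q 0" by simp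
  then have RQ: "(\<lambda>x. poly R x / poly Q x) \<in> O[at 0](\<lambda>_. 1)"
    by (rule bigoI_tendsto) simp_all
  have "\<forall>\<^sub>F x in at (0::real). \<bar>x\<bar> < 1"
    unfolding eventually_at by (intro exI[of _ 1]) (simp add: dist_real_def)
  then have ev: "\<forall>\<^sub>F x in at 0. cantor_series x - poly P x / poly Q x
      = x ^ (2 * n) * (poly R x / poly Q x + g x)"
    using evQ
  proof eventually_elim
    case (elim x)
    have "poly Q x * poly T x - poly P x = x ^ (2 * n) * poly R x"
      using arg_cong[OF R, of "\<lambda>p. poly p x"] by (simp add: poly_monom)
    then have "poly T x = poly P x / poly Q x + x ^ (2 * n) * poly R x / poly Q x"
      using elim by (simp add: field_simps)
    then show ?case
      using series[of x] elim by (simp add: T_def algebra_simps)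
  qed
  have "(\<lambda>x. x ^ (2 * n) * (poly R x / poly Q x + g x)) \<in> O[at 0](\<lambda>x. x ^ (2 * n) * 1)"
    by (intro landau_o.big.mult landau_o.big_refl sum_in_bigo RQ g)
  \<comment> \<open>The exponent \<open>n - 1 + n + 1\<close> equals \<open>2 * n\<close> only
    because \<open>n\<close> is positive, as subtraction on \<open>nat\<close> truncates.\<close>
  then have "(\<lambda>x. cantor_series x - poly P x / poly Q x) \<in> O[at 0](\<lambda>x. x ^ (n - 1 + n + 1))"
    using landau_o.big.in_cong[OF ev] assms by (simp add: mult_2)
  moreover have "degree P \<le> n - 1"
    by (intro degree_le) (auto simp: P_def coeff_poly_cutoff)
  moreover have "degree Q \<le> n"
    by (intro degree_le) (simp add: Q_coeff)
  moreover have "Q \<noteq> 0" using Q0 by auto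
  ultimately show ?thesis unfolding is_pade_approximant_def by blast
qed

end
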